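(* If a key-invariant LocalSum GNN whose combination functions are all continuous expresses a node query $\mathcal{Q}$, then $\mathcal{Q}^c$ is closed under coverings: whenever $G^u\in\mathcal{Q}^c$ and there is a covering $h:G^u\to H^v$, also $H^v\in\mathcal{Q}^c$.
   Context: Fix a finite set $\Pi=\{p_1,\dots,p_n\}$ of propositions. A graph is $G=(V,E,\mathrm{lab})$ with $V$ finite, $E\subseteq V\times V$ irreflexive and symmetric, $\mathrm{lab}:V\to\{0,1\}^n$; a pointed graph $G^u$ has distinguished node $u$; a node query is an isomorphism-closed class of pointed graphs; $\mathcal{Q}^c$ is its complement. A keyed extension adds an injective $\mathrm{key}:V\to\mathbb{R}$. A GNN is a sequence of layers $(\mathrm{agg}_i,\mathrm{com}_i)_{i=1}^\ell$, $\mathrm{com}_i:\mathbb{R}^{2D_i}\to\mathbb{R}^{D_{i+1}}$, $D_1=n+1$, $D_{\ell+1}=1$; on a keyed graph the initial embedding is $\mathrm{lab}(v)\oplus(\mathrm{key}(v))$, each layer computes $\mathrm{emb}'(u)=\mathrm{com}_i(\mathrm{emb}(u),\mathrm{agg}_i(\{\!\{\mathrm{emb}(v)\mid(u,v)\in E\}\!\}))$, output is the final value at the distinguished node. LocalSum: each $\mathrm{agg}_i$ is coordinate-wise sum. Accept iff output $>0$; key-invariant if for every pointed graph all or none of its keyed extensions are accepted; then it expresses the query of pointed graphs whose keyed extensions are accepted. A homomorphism $h:G^u\to H^v$ is a map $V(G)\to V(H)$ with $(u_0,u_1)\in E(G)\Rightarrow(h(u_0),h(u_1))\in E(H)$, $\mathrm{lab}_H(h(u_0))=\mathrm{lab}_G(u_0)$,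 and $h(u)=v$. A covering is a homomorphism such that for every $u_0\in V(G)$, $h$ maps the neighbors of $u_0$ bijectively onto the neighbors of $h(u_0)$. *)

theory Defs
  imports "HOL-Analysis.Analysis" "HOL-Library.Multiset"
begin

text \<open>
  The points of \<open>\<real>\<^sup>d\<close>, \<open>d\<close> a natural number, are those of the library's \<^term>\<open>Euclidean_space d\<close>:
  functions of type \<^typ>\<open>nat \<Rightarrow> real\<close> that vanish at all indices \<open>i \<ge> d\<close>.
\<close>

abbreviation rvec :: "nat \<Rightarrow> (nat \<Rightarrow> real) set" where
  "rvec d \<equiv> topspace (Euclidean_space d)"

definition vconcat :: "nat \<Rightarrow> (nat \<Rightarrow> real) \<Rightarrow> (nat \<Rightarrow> real) \<Rightarrow> nat \<Rightarrow> real" where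
  "vconcat d x y = (\<lambda>i. if i < d then x i else y (i - d))"

definition vsingle :: "real \<Rightarrow> nat \<Rightarrow> real" where
  "vsingle a = (\<lambda>i. if i = 0 then a else 0)"

definition bitvec :: "nat \<Rightarrow> (nat \<Rightarrow> real) set" where
  "bitvec n = {x \<in> rvec n. \<forall>i<n. x i \<in> {0, 1}}"


subsection \<open>Graphs, node queries, coverings\<close>

record 'v lgraph =
  verts :: "'v set"
  edges :: "('v \<times> 'v) set"
  lab :: "'v \<Rightarrow> nat \<Rightarrow> real"

type_synonym 'v pgraph = "'v lgraph \<times> 'v"

definition is_graph :: "nat \<Rightarrow> 'v lgraph \<Rightarrow> bool" where
  "is_graph n G \<longleftrightarrow>
     finite (verts G) \<and> edges G \<subseteq> verts G \<times> verts G \<and> irrefl (edges G) \<and> sym (edges G) \<and>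
     (\<forall>v \<in> verts G. lab G v \<in> bitvec n)"

definition pointed_graphs :: "nat \<Rightarrow> 'v pgraph set" where
  "pointed_graphs n = {(G, u). is_graph n G \<and> u \<in> verts G}"

definition nbrs :: "'v lgraph \<Rightarrow> 'v \<Rightarrow> 'v set" where
  "nbrs G u = {v. (u, v) \<in> edges G}"

definition pgraph_iso :: "('v \<Rightarrow> 'w) \<Rightarrow> 'v pgraph \<Rightarrow> 'w pgraph \<Rightarrow> bool" where
  "pgraph_iso f = (\<lambda>(G, u) (H, v).
     bij_betw f (verts G) (verts H) \<and>
     (\<forall>a \<in> verts G. \<forall>b \<in> verts G. (a, b) \<in> edges G \<longleftrightarrow> (f a, f b) \<in> edges H) \<and>
     (\<forall>a \<in> verts G. lab H (f a) = lab G a) \<and>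
     f u = v)"

text \<open>
  Nodes are drawn from an arbitrary type \<^typ>\<open>'v\<close>. If \<^typ>\<open>'v\<close> is infinite, every finite graph has
  an isomorphic copy with nodes in \<^typ>\<open>'v\<close>, so an isomorphism-closed set of pointed graphs over
  \<^typ>\<open>'v\<close> determines, and is determined by, an isomorphism-closed class of finite pointed graphs.
\<close>

definition node_query :: "nat \<Rightarrow> 'v pgraph set \<Rightarrow> bool" where
  "node_query n Q \<longleftrightarrow>
     Q \<subseteq> pointed_graphs n \<and>
     (\<forall>P \<in> Q. \<forall>P' \<in> pointed_graphs n. (\<exists>f. pgraph_iso f P P') \<longrightarrow> P' \<in> Q)"

definition query_compl :: "nat \<Rightarrow> 'v pgraph set \<Rightarrow> 'v pgraph set" where
  "query_compl n Q = pointed_graphs n - Q"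

definition pgraph_hom :: "('v \<Rightarrow> 'w) \<Rightarrow> 'v pgraph \<Rightarrow> 'w pgraph \<Rightarrow> bool" where
  "pgraph_hom h = (\<lambda>(G, u) (H, v).
     h \<in> verts G \<rightarrow> verts H \<and>
     (\<forall>a b. (a, b) \<in> edges G \<longrightarrow> (h a, h b) \<in> edges H) \<and>
     (\<forall>a \<in> verts G. lab H (h a) = lab G a) \<and>
     h u = v)"

definition covering :: "('v \<Rightarrow> 'w) \<Rightarrow> 'v pgraph \<Rightarrow> 'w pgraph \<Rightarrow> bool" where
  "covering h = (\<lambda>(G, u) (H, v).
     pgraph_hom h (G, u) (H, v) \<and>
     (\<forall>a \<in> verts G. bij_betw h (nbrs G a) (nbrs H (h a))))"

definition keyed_ext :: "'v lgraph \<Rightarrow> ('v \<Rightarrow> real) set" where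
  "keyed_ext G = {key. inj_on key (verts G)}"


subsection \<open>Graph neural networks\<close>

record layer =
  in_dim :: nat
  out_dim :: nat
  agg :: "(nat \<Rightarrow> real) multiset \<Rightarrow> nat \<Rightarrow> real"
  com :: "(nat \<Rightarrow> real) \<Rightarrow> nat \<Rightarrow> real"

definition is_layer :: "layer \<Rightarrow> bool" where
  "is_layer L \<longleftrightarrow>
     (\<forall>M. set_mset M \<subseteq> rvec (in_dim L) \<longrightarrow> agg L M \<in> rvec (in_dim L)) \<and>
     com L \<in> rvec (2 * in_dim L) \<rightarrow> rvec (out_dim L)"

text \<open>\<open>layers_from d Ls\<close>: the dimensions of \<open>Ls\<close> are composable, starting at \<open>d\<close> and ending at 1.\<close>

fun layers_from :: "nat \<Rightarrow> layer list \<Rightarrow> bool" where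
  "layers_from d [] \<longleftrightarrow> d = 1"
| "layers_from d (L # Ls) \<longleftrightarrow> in_dim L = d \<and> is_layer L \<and> layers_from (out_dim L) Ls"

definition is_gnn :: "nat \<Rightarrow> layer list \<Rightarrow> bool" where
  "is_gnn n N \<longleftrightarrow> layers_from (n + 1) N"

definition local_sum :: "layer list \<Rightarrow> bool" where
  "local_sum N \<longleftrightarrow>
     (\<forall>L \<in> set N. \<forall>M. set_mset M \<subseteq> rvec (in_dim L) \<longrightarrow> agg L M = (\<lambda>i. \<Sum>x\<in>#M. x i))"

definition continuous_com :: "layer list \<Rightarrow> bool" where
  "continuous_com N \<longleftrightarrow>
     (\<forall>L \<in> set N.
        continuous_map (Euclidean_space (2 * in_dim L)) (Euclidean_space (out_dim L)) (com L))"

definition init_emb :: "nat \<Rightarrow> 'v lgraph \<Rightarrow> ('v \<Rightarrow> real) \<Rightarrow> 'v \<Rightarrow> nat \<Rightarrow> real" where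
  "init_emb n G key v = vconcat n (lab G v) (vsingle (key v))"

definition layer_step :: "'v lgraph \<Rightarrow> layer \<Rightarrow> ('v \<Rightarrow> nat \<Rightarrow> real) \<Rightarrow> 'v \<Rightarrow> nat \<Rightarrow> real" where
  "layer_step G L emb u =
     com L (vconcat (in_dim L) (emb u) (agg L (image_mset emb (mset_set (nbrs G u)))))"

definition gnn_output :: "nat \<Rightarrow> layer list \<Rightarrow> 'v pgraph \<Rightarrow> ('v \<Rightarrow> real) \<Rightarrow> real" where
  "gnn_output n N = (\<lambda>(G, u) key. fold (layer_step G) N (init_emb n G key) u 0)"

definition accepts :: "nat \<Rightarrow> layer list \<Rightarrow> 'v pgraph \<Rightarrow> ('v \<Rightarrow> real) \<Rightarrow> bool" where
  "accepts n N P key \<longleftrightarrow> gnn_output n N P key > 0"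

text \<open>The first argument only fixes the type of the nodes.\<close>

definition key_invariant :: "'v itself \<Rightarrow> nat \<Rightarrow> layer list \<Rightarrow> bool" where
  "key_invariant _ n N \<longleftrightarrow>
     (\<forall>(G, u) \<in> (pointed_graphs n :: 'v pgraph set).
        (\<forall>key \<in> keyed_ext G. accepts n N (G, u) key) \<or>
        (\<forall>key \<in> keyed_ext G. \<not> accepts n N (G, u) key))"

definition expresses :: "nat \<Rightarrow> layer list \<Rightarrow> 'v pgraph set \<Rightarrow> bool" where
  "expresses n N Q \<longleftrightarrow>
     Q = {(G, u) \<in> pointed_graphs n. \<forall>key \<in> keyed_ext G. accepts n N (G, u) key}"

end

theory Submission
  imports Defs
begin

text \<open>
  Suppose \<open>H\<^sup>v\<close> is accepted under an injective key. Pulling the key back along a covering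
  \<open>h : G\<^sup>u \<rightarrow> H\<^sup>v\<close> gives the same output at \<open>u\<close>, because \<open>h\<close> is bijective on neighbourhoods, but the
  pulled-back key need not be injective. The output is continuous in the key, so a small
  perturbation makes the key injective while the output stays positive; by key invariance \<open>G\<^sup>u\<close> is
  then accepted under every key.
\<close>

text \<open>\<open>Euclidean_space d\<close> is a subspace of a product of copies of the real line,
  so continuity into it splits into single coordinates and vanishing from index \<open>d\<close>
  on.\<close>

lemma continuous_map_Euclidean_space_iff:
  "continuous_map X (Euclidean_space d) f \<longleftrightarrow>
     (\<forall>i. continuous_map X euclideanreal (\<lambda>x. f x i)) \<and>
     (\<forall>x\<in>topspace X. \<forall>i\<ge>d. f x i = 0)"
  unfolding Euclidean_space_def
  by (auto simp: continuous_map_in_subtopology continuous_map_componentwise_UNIV Pi_iff)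

lemma continuous_map_vconcat:
  assumes f: "continuous_map X (Euclidean_space d) f"
    and g: "continuous_map X (Euclidean_space e) g"
  shows "continuous_map X (Euclidean_space (d + e)) (\<lambda>x. vconcat d (f x) (g x))"
  using assms unfolding continuous_map_Euclidean_space_iff vconcat_def by auto

text \<open>The graph is fixed while the embeddings vary with \<open>t\<close>, so summation
  aggregates over a fixed finite set of neighbours and is continuous in \<open>t\<close>; continuity
  of \<open>com L\<close> does the rest.\<close>

lemma continuous_map_layer_step:
  assumes sum: "\<And>M. set_mset M \<subseteq> rvec (in_dim L) \<Longrightarrow> agg L M = (\<lambda>i. \<Sum>x\<in>#M. x i)"
    and com: "continuous_map (Euclidean_space (2 * in_dim L)) (Euclidean_space (out_dim L)) (com L)"
    and emb: "\<And>a. a \<in> verts G \<Longrightarrow> continuous_map X (Euclidean_space (in_dim L)) (\<lambda>t. emb t a)"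
    and G: "is_graph n G" and a: "a \<in> verts G"
  shows "continuous_map X (Euclidean_space (out_dim L)) (\<lambda>t. layer_step G L (emb t) a)"
proof -
  define S where "S t = (\<lambda>i. \<Sum>b\<in>nbrs G a. emb t b i)" for t
  have nb: "nbrs G a \<subseteq> verts G"
    using G by (auto simp: is_graph_def nbrs_def)
  have fin: "finite (nbrs G a)"
    using G nb by (auto simp: is_graph_def intro: finite_subset)
  \<comment> \<open>The hypothesis \<open>sum\<close> determines \<open>agg L\<close> only on
    multisets of vectors in \<open>rvec (in_dim L)\<close>, so \<open>t\<close> is restricted to the
    parameter space, where \<open>emb t b\<close> is such a vector.\<close>
  have agg_eq: "agg L (image_mset (emb t) (mset_set (nbrs G a))) = S t" if "t \<in> topspace X" for t
  proof -
    have "emb t b \<in> rvec (in_dim L)" if "b \<in> nbrs G a" for b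
      using emb[of b] nb that \<open>t \<in> topspace X\<close> by (auto simp: continuous_map_def)
    then show ?thesis
      using fin by (subst sum) (auto simp: S_def sum_unfold_sum_mset image_mset.compositionality comp_def)
  qed
  have "continuous_map X (Euclidean_space (in_dim L)) S"
    using emb nb fin unfolding continuous_map_Euclidean_space_iff S_def
    by (auto intro!: continuous_map_sum sum.neutral)
  then have "continuous_map X (Euclidean_space (2 * in_dim L)) (\<lambda>t. vconcat (in_dim L) (emb t a) (S t))"
    unfolding mult_2 by (intro continuous_map_vconcat emb a)
  from continuous_map_compose[OF this com]
  show ?thesis
    by (rule continuous_map_eq) (simp add: layer_step_def agg_eq)
qed

lemma continuous_map_fold_layer_step:
  assumes "layers_from d N" "local_sum N" "continuous_com N" "is_graph n G"
    and "\<And>a. a \<in> verts G \<Longrightarrow> continuous_map X (Euclidean_space d) (\<lambda>t. emb t a)"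
    and "a \<in> verts G"
  shows "continuous_map X (Euclidean_space 1) (\<lambda>t. fold (layer_step G) N (emb t) a)"
  using assms
proof (induction N arbitrary: d emb)
  case Nil
  then show ?case by simp
next
  case (Cons L N)
  have "continuous_map X (Euclidean_space (out_dim L)) (\<lambda>t. layer_step G L (emb t) b)"
    if "b \<in> verts G" for b
    using Cons.prems that
    by (intro continuous_map_layer_step) (auto simp: local_sum_def continuous_com_def)
  then show ?case
    using Cons.prems Cons.IH[of "out_dim L" "\<lambda>t. layer_step G L (emb t)"]
    by (auto simp: local_sum_def continuous_com_def)
qed

text \<open>Labels do not depend on \<open>t\<close>, so the initial embedding varies only in
  coordinate \<open>n\<close>, which holds the key.\<close>

lemma continuous_map_gnn_output:
  assumes N: "is_gnn n N" "local_sum N" "continuous_com N"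
    and G: "is_graph n G" and u: "u \<in> verts G"
    and key: "\<And>a. a \<in> verts G \<Longrightarrow> continuous_map X euclideanreal (\<lambda>t. key t a)"
  shows "continuous_map X euclideanreal (\<lambda>t. gnn_output n N (G, u) (key t))"
proof -
  have "continuous_map X (Euclidean_space (n + 1)) (\<lambda>t. init_emb n G (key t) a)"
    if "a \<in> verts G" for a
    unfolding init_emb_def
    using G that key[OF that]
    by (intro continuous_map_vconcat)
      (auto simp: continuous_map_Euclidean_space_iff vsingle_def is_graph_def bitvec_def
        topspace_Euclidean_space)
  from continuous_map_fold_layer_step[OF N(1)[unfolded is_gnn_def] N(2,3) G this u]
  show ?thesis
    by (simp add: gnn_output_def continuous_map_Euclidean_space_iff)
qed

text \<open>If embeddings agree along \<open>h\<close>, then \<open>b\<close> and \<open>h b\<close>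
  see the same multiset of neighbour embeddings, so each layer preserves the agreement.\<close>

lemma fold_layer_step_covering:
  assumes G: "is_graph n G" and cov: "covering h (G, u) (H, v)"
    and "\<And>a. a \<in> verts G \<Longrightarrow> emb a = emb' (h a)" and "a \<in> verts G"
  shows "fold (layer_step G) N emb a = fold (layer_step H) N emb' (h a)"
  using assms(3,4)
proof (induction N arbitrary: emb emb')
  case Nil
  then show ?case by simp
next
  case (Cons L N)
  have "layer_step G L emb b = layer_step H L emb' (h b)" if b: "b \<in> verts G" for b
  proof -
    have nb: "nbrs G b \<subseteq> verts G"
      using G by (auto simp: is_graph_def nbrs_def)
    then have fin: "finite (nbrs G b)"
      using G by (auto simp: is_graph_def intro: finite_subset)
    have bij: "bij_betw h (nbrs G b) (nbrs H (h b))"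
      using cov b by (auto simp: covering_def)
    have "image_mset emb (mset_set (nbrs G b)) = image_mset (\<lambda>c. emb' (h c)) (mset_set (nbrs G b))"
      using Cons.prems(1) nb fin by (intro image_mset_cong) auto
    also have "\<dots> = image_mset emb' (image_mset h (mset_set (nbrs G b)))"
      by (simp add: image_mset.compositionality comp_def)
    \<comment> \<open>Injectivity of \<open>h\<close> on the neighbourhood keeps all multiplicities
      at one; surjectivity reaches every neighbour of \<open>h b\<close>.\<close>
    also have "image_mset h (mset_set (nbrs G b)) = mset_set (nbrs H (h b))"
      using bij by (simp add: bij_betw_def image_mset_mset_set)
    finally show ?thesis
      using Cons.prems(1)[OF b] by (simp add: layer_step_def)
  qed
  then show ?case
    using Cons.IH Cons.prems(2) by simp
qed

text \<open>\<open>gnn_output\<close> accepts any real function on the nodes, so the pulled-back key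
  is a legitimate input even when nodes in one fibre of \<open>h\<close> share a value.\<close>

lemma gnn_output_covering:
  assumes "is_graph n G" "u \<in> verts G" "covering h (G, u) (H, v)"
  shows "gnn_output n N (G, u) (\<lambda>a. key (h a)) = gnn_output n N (H, v) key"
proof -
  have "h u = v" and "\<And>a. a \<in> verts G \<Longrightarrow> lab H (h a) = lab G a"
    using assms(3) by (auto simp: covering_def pgraph_hom_def)
  then show ?thesis
    using fold_layer_step_covering[OF assms(1,3) _ assms(2),
        of "init_emb n G (\<lambda>a. key (h a))" "init_emb n H key" N]
    by (simp add: gnn_output_def init_emb_def)
qed

text \<open>A collision of \<open>a\<close> and \<open>b\<close> is a linear equation in
  \<open>t\<close>. If \<open>k a = k b\<close>, injectivity of \<open>f\<close> excludes every
  \<open>t\<close> other than 0; otherwise the difference tends to \<open>k a - k b\<close>, which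
  is nonzero. Only finitely many pairs have to be avoided.\<close>

lemma eventually_inj_on_perturbed:
  fixes k f :: "'a \<Rightarrow> real"
  assumes "finite A" and f: "inj_on f A"
  shows "eventually (\<lambda>t. inj_on (\<lambda>a. k a + t * f a) A) (at 0)"
proof -
  have "eventually (\<lambda>t. k a + t * f a \<noteq> k b + t * f b) (at 0)"
    if "a \<in> A" "b \<in> A" "a \<noteq> b" for a b
  proof (cases "k a = k b")
    case True
    have "f a \<noteq> f b"
      using f that by (auto dest: inj_onD)
    then show ?thesis
      using True by (auto simp: eventually_at_filter)
  next
    case False
    have "((\<lambda>t. k a + t * f a - (k b + t * f b)) \<longlongrightarrow> k a + 0 * f a - (k b + 0 * f b)) (at 0)"
      by (intro tendsto_intros)
    from tendsto_imp_eventually_ne[OF this, of 0] show ?thesis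
      using False by simp
  qed
  then have "eventually (\<lambda>t. a \<noteq> b \<longrightarrow> k a + t * f a \<noteq> k b + t * f b) (at 0)"
    if "a \<in> A" "b \<in> A" for a b
    using that by (cases "a = b") auto
  then have "eventually (\<lambda>t. \<forall>a\<in>A. \<forall>b\<in>A. a \<noteq> b \<longrightarrow> k a + t * f a \<noteq> k b + t * f b) (at 0)"
    using \<open>finite A\<close> by (intro eventually_ball_finite ballI)
  then show ?thesis
    by (rule eventually_mono) (auto simp: inj_on_def)
qed

lemma finite_ex_inj_on_real:
  assumes "finite A"
  shows "\<exists>f :: 'a \<Rightarrow> real. inj_on f A"
proof -
  obtain g :: "'a \<Rightarrow> nat" where "inj_on g A"
    using finite_imp_inj_to_nat_seg[OF assms] by auto
  then have "inj_on (\<lambda>a. real (g a)) A"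
    by (auto simp: inj_on_def)
  then show ?thesis by blast
qed

lemma ex_injective_key_gnn_output_pos:
  assumes N: "is_gnn n N" "local_sum N" "continuous_com N"
    and G: "is_graph n G" and u: "u \<in> verts G"
    and pos: "gnn_output n N (G, u) k > 0"
  shows "\<exists>key\<in>keyed_ext G. gnn_output n N (G, u) key > 0"
proof -
  have fin: "finite (verts G)"
    using G by (simp add: is_graph_def)
  then obtain f :: "'a \<Rightarrow> real" where f: "inj_on f (verts G)"
    using finite_ex_inj_on_real by blast
  \<comment> \<open>Moving along the line through \<open>k\<close> in direction \<open>f\<close>
    reduces the perturbation to one real parameter, with \<open>k\<close> itself at
    \<open>t = 0\<close>.\<close>
  define out where "out t = gnn_output n N (G, u) (\<lambda>a. k a + t * f a)" for t
  have "continuous_map euclideanreal euclideanreal out"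
    unfolding out_def
    by (intro continuous_map_gnn_output N G u) (simp add: continuous_intros)
  then have "(out \<longlongrightarrow> out 0) (at 0)"
    by (auto simp: continuous_on_eq_continuous_at isCont_def)
  moreover have "out 0 > 0"
    using pos by (simp add: out_def)
  ultimately have "eventually (\<lambda>t. out t > 0) (at 0)"
    by (rule order_tendstoD)
  then have "eventually (\<lambda>t. out t > 0 \<and> inj_on (\<lambda>a. k a + t * f a) (verts G)) (at 0)"
    using eventually_inj_on_perturbed[OF fin f] by (rule eventually_conj)
  \<comment> \<open>The punctured neighbourhood filter at a real point is nontrivial, so a property
    that holds eventually has a witness.\<close>
  then obtain t where "out t > 0" "inj_on (\<lambda>a. k a + t * f a) (verts G)"
    using eventually_happens[of _ "at (0::real)"] by auto
  then show ?thesis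
    by (auto simp: out_def keyed_ext_def)
qed

theorem theorem5p3:
  fixes n :: nat and N :: "layer list" and Q :: "'v pgraph set"
  assumes "node_query n Q"
    and "is_gnn n N"
    and "local_sum N"
    and "continuous_com N"
    and "key_invariant TYPE('v) n N"
    and "expresses n N Q"
  shows "\<forall>G u H v h. (G, u) \<in> query_compl n Q \<and> (H, v) \<in> pointed_graphs n \<and>
           covering h (G, u) (H, v) \<longrightarrow> (H, v) \<in> query_compl n Q"
proof (intro allI impI, elim conjE)
  fix G H :: "'v lgraph" and u v h
  assume Gu: "(G, u) \<in> query_compl n Q" and Hv: "(H, v) \<in> pointed_graphs n"
    and cov: "covering h (G, u) (H, v)"
  have Gu_pt: "(G, u) \<in> pointed_graphs n" and Gu_Q: "(G, u) \<notin> Q"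
    using Gu by (auto simp: query_compl_def)
  then have G: "is_graph n G" and u: "u \<in> verts G"
    by (auto simp: pointed_graphs_def)
  have "(H, v) \<notin> Q"
  proof
    assume "(H, v) \<in> Q"
    moreover have "finite (verts H)"
      using Hv by (simp add: pointed_graphs_def is_graph_def)
    \<comment> \<open>Membership in \<open>Q\<close> only says that all injective keys are accepted;
      finiteness of \<open>H\<close> supplies an actual one.\<close>
    then obtain k :: "'v \<Rightarrow> real" where "k \<in> keyed_ext H"
      using finite_ex_inj_on_real by (auto simp: keyed_ext_def)
    ultimately have "gnn_output n N (H, v) k > 0"
      using assms(6) by (auto simp: expresses_def accepts_def)
    then have "gnn_output n N (G, u) (\<lambda>a. k (h a)) > 0"
      by (simp add: gnn_output_covering[OF G u cov])
    then obtain key where "key \<in> keyed_ext G" "accepts n N (G, u) key"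
      using ex_injective_key_gnn_output_pos[OF assms(2-4) G u] by (auto simp: accepts_def)
    \<comment> \<open>One accepted injective key rules out the all-rejecting alternative of key
      invariance.\<close>
    then have "\<forall>key \<in> keyed_ext G. accepts n N (G, u) key"
      using assms(5) Gu_pt by (fastforce simp: key_invariant_def)
    then have "(G, u) \<in> Q"
      using assms(6) Gu_pt by (simp add: expresses_def)
    then show False
      using Gu_Q by contradiction
  qed
  then show "(H, v) \<in> query_compl n Q"
    using Hv by (simp add: query_compl_def)
qed

end
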